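(* Let $n\ge 1$ be an integer, let $p\in[2,\infty)$, and let $f:B_{\ell_p^n}\to B_{\ell_p^n}$ be holomorphic with $f(0)=0$. Suppose that $f$ is holomorphic at a point $z_0\in\partial B_{\ell_p^n}$ and that $f(z_0)=w_0\in\partial B_{\ell_p^n}$. Then the following two statements hold: (1) $J_f(z_0)\,\mathcal{T}_{z_0}(\partial B_{\ell_p^n})\subset \mathcal{T}_{w_0}(\partial B_{\ell_p^n})$ and $J_f(z_0)\,\mathcal{T}^{1,0}_{z_0}(\partial B_{\ell_p^n})\subset \mathcal{T}^{1,0}_{w_0}(\partial B_{\ell_p^n})$; (2) there exists a real number $\lambda\ge 1$ such that $\overline{J_f(z_0)}^{T}v_{w_0}=\lambda v_{z_0}$, or, equivalently, $\overline{v_{w_0}}^{T}J_f(z_0)=\lambda\,\overline{v_{z_0}}^{T}$.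
   Context: $B_{\ell_p^n}=\{z\in\mathbb{C}^n:\|z\|_p=(|z_1|^p+\cdots+|z_n|^p)^{1/p}<1\}$, with boundary $\partial B_{\ell_p^n}=\{z\in\mathbb{C}^n:\|z\|_p=1\}$. Points of $\mathbb{C}^n$ are regarded as column vectors, $T$ denotes transpose and the bar denotes entrywise complex conjugation. "$f$ is holomorphic at $z_0\in\partial B_{\ell_p^n}$" means that $f$ extends holomorphically to a neighbourhood of $z_0$; $f(z_0)$ and the complex Jacobian matrix $J_f(z_0)=\left(\frac{\partial f_i}{\partial z_j}(z_0)\right)_{n\times n}$ refer to this extension. For $z\in\partial B_{\ell_p^n}$ put $v_z=(|z_1|^{p-2}z_1,\dots,|z_n|^{p-2}z_n)^T$. With $\rho(z)=\|z\|_p^p-1$, the gradient is $\nabla\rho(z)=2\left(\frac{\partial\rho}{\partial\overline{z_1}}(z),\dots,\frac{\partial\rho}{\partial\overline{z_n}}(z)\right)^T=p\,v_z$. The tangent space and the complex tangent space to $\partial B_{\ell_p^n}$ at $z\in\partial B_{\ell_p^n}$ are, respectively, $$\mathcal{T}_z(\partial B_{\ell_p^n})=\left\{\alpha\in\mathbb{C}^n:\operatorname{Re}\left[\overline{\nabla\rho(z)}^{T}\alpha\right]=0\right\},\qquad \mathcal{T}^{1,0}_z(\partial B_{\ell_p^n})=\left\{\alpha\in\mathbb{C}^n:\overline{\nabla\rho(z)}^{T}\alpha=0\right\}.$$ *)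

theory Defs
  imports "HOL-Analysis.Analysis"
begin

text \<open>
  Since \<^term>\<open>0 powr a = (0::real)\<close>, the expressions below have the intended values also at
  vanishing coordinates (for \<^term>\<open>p = (2::real)\<close>, the weight in \<open>lp_v\<close> multiplies the
  coordinate 0).
\<close>

definition lp_norm :: "real \<Rightarrow> complex ^ 'n \<Rightarrow> real"
  where "lp_norm p z = (\<Sum>i\<in>UNIV. cmod (z $ i) powr p) powr (1 / p)"

definition lp_ball :: "real \<Rightarrow> (complex ^ 'n) set"
  where "lp_ball p = {z. lp_norm p z < 1}"

definition lp_sphere :: "real \<Rightarrow> (complex ^ 'n) set"
  where "lp_sphere p = {z. lp_norm p z = 1}"

definition lp_v :: "real \<Rightarrow> complex ^ 'n \<Rightarrow> complex ^ 'n"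
  where "lp_v p z = (\<chi> i. of_real (cmod (z $ i) powr (p - 2)) * z $ i)"

definition cnj_vec :: "complex ^ 'n \<Rightarrow> complex ^ 'n"
  where "cnj_vec z = (\<chi> i. cnj (z $ i))"

text \<open>
  Holomorphy in several variables: the set is open, and at each of its points the map is
  differentiable with complex-linear derivative (given by a complex matrix).
\<close>

definition vec_holomorphic_on :: "(complex ^ 'n \<Rightarrow> complex ^ 'm) \<Rightarrow> (complex ^ 'n) set \<Rightarrow> bool"
  where "vec_holomorphic_on f S \<longleftrightarrow>
    open S \<and> (\<forall>z\<in>S. \<exists>A :: complex ^ 'n ^ 'm. (f has_derivative (\<lambda>h. A *v h)) (at z))"

text \<open>
  \<open>F\<close> is a holomorphic extension of \<open>f\<close>, given on \<open>S\<close>, to a neighbourhood of \<open>z0\<close>.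
  Values of \<open>F\<close> away from that neighbourhood are irrelevant.
\<close>

definition holomorphic_extension_at ::
    "(complex ^ 'n \<Rightarrow> complex ^ 'm) \<Rightarrow> (complex ^ 'n) set \<Rightarrow> complex ^ 'n \<Rightarrow>
     (complex ^ 'n \<Rightarrow> complex ^ 'm) \<Rightarrow> bool"
  where "holomorphic_extension_at f S z0 F \<longleftrightarrow>
    (\<exists>U. z0 \<in> U \<and> vec_holomorphic_on F U \<and> (\<forall>z \<in> U \<inter> S. F z = f z))"

definition complex_jacobian :: "(complex ^ 'n \<Rightarrow> complex ^ 'm) \<Rightarrow> complex ^ 'n \<Rightarrow> complex ^ 'n ^ 'm"
  where "complex_jacobian f z = (\<chi> i j. deriv (\<lambda>t. f (z + axis j t) $ i) 0)"

text \<open>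
  The Wirtinger derivative with respect to the conjugate of \<open>z\<^sub>j = x\<^sub>j + \<i> y\<^sub>j\<close>,
  namely \<open>(\<partial>/\<partial>x\<^sub>j + \<i> \<partial>/\<partial>y\<^sub>j) / 2\<close>.
\<close>

definition wirtinger_cnj :: "(complex ^ 'n \<Rightarrow> complex) \<Rightarrow> 'n \<Rightarrow> complex ^ 'n \<Rightarrow> complex"
  where "wirtinger_cnj g j z =
    (vector_derivative (\<lambda>t::real. g (z + axis j (of_real t))) (at 0) +
     \<i> * vector_derivative (\<lambda>t::real. g (z + axis j (\<i> * of_real t))) (at 0)) / 2"

definition lp_rho :: "real \<Rightarrow> complex ^ 'n \<Rightarrow> real"
  where "lp_rho p z = lp_norm p z powr p - 1"

definition lp_grad :: "real \<Rightarrow> complex ^ 'n \<Rightarrow> complex ^ 'n"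
  where "lp_grad p z = (\<chi> j. 2 * wirtinger_cnj (\<lambda>w. of_real (lp_rho p w)) j z)"

definition lp_tangent :: "real \<Rightarrow> complex ^ 'n \<Rightarrow> (complex ^ 'n) set"
  where "lp_tangent p z = {\<alpha>. Re (\<Sum>j\<in>UNIV. cnj (lp_grad p z $ j) * \<alpha> $ j) = 0}"

definition lp_complex_tangent :: "real \<Rightarrow> complex ^ 'n \<Rightarrow> (complex ^ 'n) set"
  where "lp_complex_tangent p z = {\<alpha>. (\<Sum>j\<in>UNIV. cnj (lp_grad p z $ j) * \<alpha> $ j) = 0}"

lemma norm_powr_has_real_derivative:
  fixes a b :: complex
  assumes p: "p \<ge> 2" and b: "cmod b = 1"
  shows "((\<lambda>t::real. cmod (a + b * of_real t) powr p)
           has_real_derivative p * cmod a powr (p - 2) * (a \<bullet> b)) (at 0)"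
proof (cases "a = 0")
  case False
  have 1: "((\<lambda>t::real. a + b * of_real t) has_derivative (\<lambda>t. b * of_real t)) (at 0)"
    by (auto intro!: derivative_eq_intros)
  have 2: "(norm has_derivative (\<lambda>h. h \<bullet> sgn a)) (at (a + b * of_real 0))"
    using has_derivative_norm[OF False] by simp
  have "((\<lambda>t::real. cmod (a + b * of_real t)) has_derivative (\<lambda>t. (b * of_real t) \<bullet> sgn a)) (at 0)"
    using has_derivative_compose[OF 1 2] by simp
  moreover have "(\<lambda>t. (b * of_real t) \<bullet> sgn a) = (*) (b \<bullet> sgn a)"
    by (auto simp: inner_complex_def algebra_simps)
  ultimately have 3: "((\<lambda>t::real. cmod (a + b * of_real t)) has_real_derivative b \<bullet> sgn a) (at 0)"
    by (simp add: has_field_derivative_def)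
  have pos: "cmod a > 0" using False by simp
  have "((\<lambda>t::real. cmod (a + b * of_real t) powr p) has_real_derivative
      p * cmod a powr (p - 1) * (b \<bullet> sgn a)) (at 0)"
    using DERIV_fun_powr[OF 3, of p] pos by (simp add: mult_ac)
  moreover have "cmod a powr (p - 1) * (b \<bullet> sgn a) = cmod a powr (p - 2) * (a \<bullet> b)"
  proof -
    have "cmod a powr (p - 1) = cmod a powr (p - 2) * cmod a"
      using pos powr_add[of "cmod a" "p - 2" 1] by simp
    moreover have "cmod a * (b \<bullet> sgn a) = a \<bullet> b"
      using pos by (simp add: sgn_div_norm inner_commute)
    ultimately show ?thesis by (simp add: mult.assoc)
  qed
  ultimately show ?thesis by (simp add: mult.assoc)
next
  case True
  have "((\<lambda>t::real. \<bar>t\<bar> powr p / t) \<longlongrightarrow> 0) (at 0)"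
  proof (rule tendsto_norm_zero_cancel)
    have "((\<lambda>t::real. \<bar>t\<bar> powr (p - 1)) \<longlongrightarrow> 0 powr (p - 1)) (at 0)"
      using p by (intro tendsto_powr') (auto intro!: tendsto_eq_intros)
    moreover have "\<forall>\<^sub>F t::real in at 0. norm (\<bar>t\<bar> powr p / t) = \<bar>t\<bar> powr (p - 1)"
      by (auto simp: eventually_at_filter powr_diff intro!: always_eventually)
    ultimately show "((\<lambda>t::real. norm (\<bar>t\<bar> powr p / t)) \<longlongrightarrow> 0) (at 0)"
      by (simp add: tendsto_cong)
  qed
  then show ?thesis
    using True b by (simp add: has_field_derivative_iff norm_mult)
qed

lemma lp_rho_eq: "p \<ge> 2 \<Longrightarrow> lp_rho p z = (\<Sum>i\<in>UNIV. cmod (z $ i) powr p) - 1"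
  by (simp add: lp_rho_def lp_norm_def powr_powr sum_nonneg)

lemma lp_rho_directional:
  fixes z :: "complex ^ 'n"
  assumes p: "p \<ge> 2" and b: "cmod b = 1"
  shows "((\<lambda>t::real. complex_of_real (lp_rho p (z + axis j (b * of_real t)))) has_vector_derivative
           of_real (p * cmod (z $ j) powr (p - 2) * (z $ j \<bullet> b))) (at 0)"
proof -
  define D where "D = p * cmod (z $ j) powr (p - 2) * (z $ j \<bullet> b)"
  have eq: "lp_rho p (z + axis j (b * of_real t)) =
      cmod (z $ j + b * of_real t) powr p + ((\<Sum>i\<in>UNIV - {j}. cmod (z $ i) powr p) - 1)" for t :: real
    unfolding lp_rho_eq[OF p] by (subst sum.remove[of UNIV j]) (auto simp: axis_def)
  have "((\<lambda>t. lp_rho p (z + axis j (b * of_real t))) has_real_derivative D) (at 0)"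
    unfolding eq D_def
    using DERIV_add[OF norm_powr_has_real_derivative[OF p b, of "z $ j"] DERIV_const] by simp
  then show ?thesis
    unfolding D_def[symmetric]
    by (intro has_vector_derivative_of_real)
       (simp add: has_real_derivative_iff_has_vector_derivative)
qed

lemma lp_grad_eq:
  fixes z :: "complex ^ 'n"
  assumes p: "p \<ge> 2"
  shows "lp_grad p z = of_real p *s lp_v p z"
proof -
  have "lp_grad p z $ j = of_real p * lp_v p z $ j" for j
    using vector_derivative_at[OF lp_rho_directional[OF p, of 1 z j]]
      vector_derivative_at[OF lp_rho_directional[OF p, of \<i> z j]]
    by (simp add: lp_grad_def wirtinger_cnj_def lp_v_def complex_eq_iff)
  then show ?thesis by (simp add: vec_eq_iff)
qed

end

theory Submission
  imports Defs "HOL-Complex_Analysis.Conformal_Mappings"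
begin

text \<open>
  The vector \<open>v\<close> at a boundary point \<open>w\<close> represents the norming functional of \<open>w\<close>:
  \<open>\<ell>\<^sub>w(z) = \<Sum>\<^sub>i cnj (v\<^sub>i) z\<^sub>i\<close> is complex linear, takes the value 1 at \<open>w\<close>, and is smaller than 1 in
  modulus on the ball by Young's inequality (\<open>norming_functional_less_one\<close>). Up to the factor
  \<open>p\<close>, its real part is also the derivative of the defining function \<open>\<rho>\<close> at \<open>w\<close>.

  Let \<open>A\<close> be the Jacobian at \<open>z\<^sub>0\<close> and \<open>L(\<alpha>) = \<ell>\<^sub>w\<^sub>0(A \<alpha>)\<close>. If \<open>Re \<ell>\<^sub>z\<^sub>0(\<alpha>) < 0\<close>, the segment from
  \<open>z\<^sub>0\<close> in direction \<open>\<alpha>\<close> starts inside the ball. There \<open>Re \<ell>\<^sub>w\<^sub>0 \<circ> F\<close> is below 1, its value at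
  \<open>z\<^sub>0\<close>, and hence \<open>Re L(\<alpha>) \<le> 0\<close> (\<open>derivative_nonpos_in_inward_directions\<close>). So \<open>Re L\<close> is
  nonpositive on a half-space bounded by the kernel of \<open>Re \<ell>\<^sub>z\<^sub>0\<close>. This makes it a multiple
  \<open>\<lambda> Re \<ell>\<^sub>z\<^sub>0\<close>, and complex linearity turns this into \<open>L = \<lambda> \<ell>\<^sub>z\<^sub>0\<close> with \<open>\<lambda>\<close> real
  (\<open>functional_multiple_of_half_space\<close>). Read coordinatewise, this is the
  equation for \<open>v\<close> at \<open>z\<^sub>0\<close> and \<open>w\<^sub>0\<close>; as the two tangent spaces at \<open>z\<close> are the kernels of
  \<open>Re \<ell>\<^sub>z\<close> and \<open>\<ell>\<^sub>z\<close>, it also shows that the Jacobian maps tangent vectors to tangent vectors.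

  Finally \<open>\<lambda> = L(z\<^sub>0)\<close> is a radial derivative. The function \<open>\<zeta> \<mapsto> \<ell>\<^sub>w\<^sub>0(f(\<zeta> z\<^sub>0))\<close> maps the unit disc into
  itself and fixes 0, so the Schwarz lemma bounds it by \<open>|\<zeta>|\<close>. Since its extension equals 1 at
  \<open>\<zeta> = 1\<close>, comparing derivatives along the radius gives \<open>\<lambda> \<ge> 1\<close>
  (\<open>radial_derivative_ge_one\<close>).
\<close>

section \<open>Norming functionals\<close>

definition norming_functional :: "real \<Rightarrow> complex ^ 'n \<Rightarrow> complex ^ 'n \<Rightarrow> complex"
  where "norming_functional p w z = (\<Sum>i\<in>UNIV. cnj (lp_v p w $ i) * z $ i)"

lemma lp_ball_iff:
  assumes "p \<ge> 2"
  shows "z \<in> lp_ball p \<longleftrightarrow> (\<Sum>i\<in>UNIV. cmod (z $ i) powr p) < 1"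
proof -
  have nonneg: "(\<Sum>i\<in>UNIV. cmod (z $ i) powr p) \<ge> 0" by (simp add: sum_nonneg)
  have "x powr (1/p) < 1 \<longleftrightarrow> x < 1" if "x \<ge> 0" for x :: real
    using that assms powr_less_mono2[of "1/p" x 1] powr_mono2[of "1/p" 1 x] by (cases "x < 1") auto
  with nonneg show ?thesis by (simp add: lp_ball_def lp_norm_def)
qed

lemma lp_sphere_iff:
  assumes "p \<ge> 2"
  shows "z \<in> lp_sphere p \<longleftrightarrow> (\<Sum>i\<in>UNIV. cmod (z $ i) powr p) = 1"
proof -
  define S where "S = (\<Sum>i\<in>UNIV. cmod (z $ i) powr p)"
  have "S \<ge> 0" by (simp add: S_def sum_nonneg)
  then have "S powr (1/p) = 1 \<longleftrightarrow> S = 1"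
    using assms powr_inj[of S 1 "1/p"] powr_powr[of S "1/p" p] by auto
  then show ?thesis by (simp add: lp_sphere_def lp_norm_def S_def)
qed

lemma scaled_sphere_in_ball:
  fixes z :: "complex ^ 'n"
  assumes p: "p \<ge> 2" and z: "z \<in> lp_sphere p" and c: "cmod c < 1"
  shows "c *s z \<in> lp_ball p"
proof -
  have "(\<Sum>i\<in>UNIV. cmod ((c *s z) $ i) powr p) = cmod c powr p * (\<Sum>i\<in>UNIV. cmod (z $ i) powr p)"
    by (simp add: norm_mult powr_mult sum_distrib_left)
  also have "\<dots> = cmod c powr p" using z p by (simp add: lp_sphere_iff)
  also have "\<dots> < 1" using c p powr_less_mono2[of p "cmod c" 1] by simp
  finally show ?thesis using p by (simp add: lp_ball_iff)
qed

lemma bounded_linear_norming_functional: "bounded_linear (norming_functional p w)"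
  unfolding norming_functional_def
  by (intro bounded_linear_sum bounded_linear_const_mult bounded_linear_vec_nth)

lemma norming_functional_simps:
  "norming_functional p w (x + y) = norming_functional p w x + norming_functional p w y"
  "norming_functional p w (c *s x) = c * norming_functional p w x"
  "norming_functional p w 0 = 0"
  "norming_functional p w (axis j 1) = cnj (lp_v p w $ j)"
  by (auto simp: norming_functional_def algebra_simps sum.distrib sum_distrib_left axis_def
      if_distrib cong: if_cong)

lemma norming_functional_self:
  assumes p: "p \<ge> 2" and w: "w \<in> lp_sphere p"
  shows "norming_functional p w w = 1"
proof -
  have "cnj (lp_v p w $ i) * w $ i = of_real (cmod (w $ i) powr p)" for i
  proof (cases "w $ i = 0")
    case False
    have "cnj (lp_v p w $ i) * w $ i = of_real (cmod (w $ i) powr (p - 2)) * (cnj (w $ i) * w $ i)"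
      by (simp add: lp_v_def)
    also have "cnj (w $ i) * w $ i = of_real (cmod (w $ i) powr 2)"
      using complex_norm_square[of "w $ i"] by (simp add: powr_numeral mult.commute)
    finally show ?thesis by (simp flip: of_real_mult powr_add del: powr_numeral)
  qed (use p in simp)
  then have "norming_functional p w w = of_real (\<Sum>i\<in>UNIV. cmod (w $ i) powr p)"
    by (simp add: norming_functional_def)
  then show ?thesis using w p by (simp add: lp_sphere_iff del: of_real_sum)
qed

text \<open>
  Hoelder's inequality for the pair \<open>w\<close>, \<open>z\<close>. Because one of the two points lies on the unit
  sphere, Young's inequality applied coordinatewise and summed already gives it.
\<close>

lemma norming_functional_less_one:
  assumes p: "p \<ge> 2" and w: "w \<in> lp_sphere p" and z: "z \<in> lp_ball p"
  shows "cmod (norming_functional p w z) < 1"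
proof -
  define q where "q = p / (p - 1)"
  have q: "q > 1" "1/p + 1/q = 1" using p by (auto simp: q_def field_simps)
  have coord: "cmod (cnj (lp_v p w $ i) * z $ i) \<le> cmod (z $ i) powr p / p + cmod (w $ i) powr p / q"
    for i
  proof -
    have "cmod (cnj (lp_v p w $ i) * z $ i) = cmod (z $ i) * cmod (w $ i) powr (p - 1)"
    proof (cases "w $ i = 0")
      case False
      then have "cmod (w $ i) powr (p - 1) = cmod (w $ i) powr (p - 2) * cmod (w $ i)"
        using powr_add[of "cmod (w $ i)" "p - 2" 1] by simp
      then show ?thesis by (simp add: lp_v_def norm_mult mult_ac)
    qed (simp add: lp_v_def)
    also have "\<dots> \<le> cmod (z $ i) powr p / p + (cmod (w $ i) powr (p - 1)) powr q / q"
      using p q by (intro Youngs_inequality) auto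
    also have "(cmod (w $ i) powr (p - 1)) powr q = cmod (w $ i) powr p"
      using p by (simp add: powr_powr q_def)
    finally show ?thesis .
  qed
  have "cmod (norming_functional p w z)
      \<le> (\<Sum>i\<in>UNIV. cmod (z $ i) powr p / p + cmod (w $ i) powr p / q)"
    unfolding norming_functional_def by (intro order.trans[OF norm_sum] sum_mono coord)
  also have "\<dots> = (\<Sum>i\<in>UNIV. cmod (z $ i) powr p) / p + (\<Sum>i\<in>UNIV. cmod (w $ i) powr p) / q"
    by (simp add: sum.distrib sum_divide_distrib)
  also have "\<dots> < 1 / p + 1 / q"
    using z w p by (auto simp: lp_ball_iff lp_sphere_iff intro: divide_strict_right_mono)
  finally show ?thesis using q by simp
qed

text \<open>
  The derivative of \<open>t \<mapsto> |a + t b|\<^sup>p\<close> for a unit vector \<open>b\<close> gives the one for arbitrary \<open>b\<close> by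
  rescaling \<open>t\<close>.
\<close>

lemma sum_powr_directional_derivative:
  fixes z \<alpha> :: "complex ^ 'n"
  assumes p: "p \<ge> 2"
  shows "((\<lambda>t::real. \<Sum>i\<in>UNIV. cmod ((z + t *\<^sub>R \<alpha>) $ i) powr p)
           has_real_derivative p * Re (norming_functional p z \<alpha>)) (at 0)"
proof -
  have coord: "((\<lambda>t::real. cmod (a + t *\<^sub>R b) powr p) has_real_derivative
      p * cmod a powr (p - 2) * (a \<bullet> b)) (at 0)" for a b :: complex
  proof (cases "b = 0")
    case False
    have "cmod (sgn b) = 1" using False by (simp add: norm_sgn)
    from norm_powr_has_real_derivative[OF p this, of a]
    have "((\<lambda>t. cmod (a + sgn b * of_real t) powr p) has_real_derivative
        p * cmod a powr (p - 2) * (a \<bullet> sgn b)) (at (cmod b * 0))" by simp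
    moreover have "((\<lambda>t. cmod b * t) has_real_derivative cmod b) (at 0)"
      by (auto intro!: derivative_eq_intros)
    ultimately have "((\<lambda>t. cmod (a + sgn b * of_real (cmod b * t)) powr p) has_real_derivative
        p * cmod a powr (p - 2) * (a \<bullet> sgn b) * cmod b) (at 0)"
      by (rule DERIV_chain2)
    moreover have "sgn b * of_real (cmod b * t) = t *\<^sub>R b" for t
      using False by (simp add: sgn_eq scaleR_conv_of_real)
    moreover have "(a \<bullet> sgn b) * cmod b = a \<bullet> b"
      using False by (simp add: sgn_div_norm)
    ultimately show ?thesis by (simp add: mult.assoc)
  qed simp
  have "((\<lambda>t::real. \<Sum>i\<in>UNIV. cmod ((z + t *\<^sub>R \<alpha>) $ i) powr p) has_real_derivative
      (\<Sum>i\<in>UNIV. p * cmod (z $ i) powr (p - 2) * (z $ i \<bullet> \<alpha> $ i))) (at 0)"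
    using DERIV_sum[of UNIV, OF coord] by simp
  moreover have "(\<Sum>i\<in>UNIV. p * cmod (z $ i) powr (p - 2) * (z $ i \<bullet> \<alpha> $ i))
      = p * Re (norming_functional p z \<alpha>)"
    by (simp add: norming_functional_def lp_v_def inner_complex_def sum_distrib_left algebra_simps)
  ultimately show ?thesis by simp
qed

section \<open>Derivatives at a boundary point\<close>

lemma derivative_nonpos_at_right_maximum:
  fixes g :: "real \<Rightarrow> real"
  assumes der: "(g has_real_derivative D) (at 0)"
    and max: "\<forall>\<^sub>F t in at_right 0. g t \<le> g 0"
  shows "D \<le> 0"
proof (rule ccontr)
  assume "\<not> D \<le> 0"
  then obtain d where d: "d > 0" "\<And>h. 0 < h \<Longrightarrow> h < d \<Longrightarrow> g 0 < g h"
    using DERIV_pos_inc_right[OF der] by auto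
  have "\<forall>\<^sub>F t in at_right 0. t \<in> {0<..<d}"
    using d(1) by (rule eventually_at_right_real)
  with max have "\<forall>\<^sub>F t in at_right (0::real). False"
    by eventually_elim (use d in fastforce)
  then show False by (simp add: trivial_limit_at_right_real)
qed

lemma inward_direction_enters_ball:
  fixes z \<alpha> :: "complex ^ 'n"
  assumes p: "p \<ge> 2" and z: "z \<in> lp_sphere p" and \<alpha>: "Re (norming_functional p z \<alpha>) < 0"
  shows "\<forall>\<^sub>F t in at_right 0. z + t *\<^sub>R \<alpha> \<in> lp_ball p"
proof -
  have "p * Re (norming_functional p z \<alpha>) < 0" using p \<alpha> by (simp add: mult_pos_neg)
  from DERIV_neg_dec_right[OF sum_powr_directional_derivative[OF p] this]
  obtain d where d: "d > 0" "\<And>h. 0 < h \<Longrightarrow> h < d \<Longrightarrow>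
      (\<Sum>i\<in>UNIV. cmod ((z + h *\<^sub>R \<alpha>) $ i) powr p) < (\<Sum>i\<in>UNIV. cmod (z $ i) powr p)"
    by auto
  then show ?thesis
    using z p by (auto simp: lp_ball_iff lp_sphere_iff eventually_at_right_field)
qed

lemma eventually_on_segment:
  fixes z \<alpha> :: "'a :: real_normed_vector"
  assumes "open U" "z \<in> U"
  shows "\<forall>\<^sub>F t in at_right 0. z + t *\<^sub>R \<alpha> \<in> U"
proof -
  have "((\<lambda>t. z + t *\<^sub>R \<alpha>) \<longlongrightarrow> z + 0 *\<^sub>R \<alpha>) (at_right 0)"
    by (intro tendsto_intros)
  with assms show ?thesis by (auto dest: topological_tendstoD)
qed

lemma norming_functional_directional_derivative:
  fixes F :: "complex ^ 'n \<Rightarrow> complex ^ 'n"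
  assumes "(F has_derivative (\<lambda>h. A *v h)) (at z)"
  shows "((\<lambda>t::real. Re (norming_functional p w (F (z + t *\<^sub>R \<alpha>)))) has_real_derivative
           Re (norming_functional p w (A *v \<alpha>))) (at 0)"
proof -
  have "((\<lambda>t::real. z + t *\<^sub>R \<alpha>) has_derivative (\<lambda>t. t *\<^sub>R \<alpha>)) (at 0)"
    by (auto intro!: derivative_eq_intros)
  moreover have "(F has_derivative (\<lambda>h. A *v h)) (at (z + 0 *\<^sub>R \<alpha>))" using assms by simp
  ultimately have "((\<lambda>t::real. F (z + t *\<^sub>R \<alpha>)) has_derivative (\<lambda>t. A *v (t *\<^sub>R \<alpha>))) (at 0)"
    by (rule has_derivative_compose)
  from bounded_linear.has_derivative[OF bounded_linear_Re
      bounded_linear.has_derivative[OF bounded_linear_norming_functional[of p w] this]]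
  have "((\<lambda>t::real. Re (norming_functional p w (F (z + t *\<^sub>R \<alpha>)))) has_derivative
      (\<lambda>t. Re (norming_functional p w (A *v (t *\<^sub>R \<alpha>))))) (at 0)" .
  moreover have "Re (norming_functional p w (A *v (t *\<^sub>R \<alpha>))) = Re (norming_functional p w (A *v \<alpha>)) * t"
    for t
    by (simp add: linear_cmul[OF matrix_vector_mul_linear] mult.commute
        linear_cmul[OF bounded_linear.linear[OF bounded_linear_norming_functional]])
  ultimately show ?thesis by (simp add: has_field_derivative_def)
qed

lemma derivative_nonpos_in_inward_directions:
  fixes F :: "complex ^ 'n \<Rightarrow> complex ^ 'n"
  assumes p: "p \<ge> 2" and z: "z \<in> lp_sphere p" and w: "F z \<in> lp_sphere p"
    and F: "(F has_derivative (\<lambda>h. A *v h)) (at z)"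
    and U: "open U" "z \<in> U" and into: "F ` (U \<inter> lp_ball p) \<subseteq> lp_ball p"
    and \<alpha>: "Re (norming_functional p z \<alpha>) < 0"
  shows "Re (norming_functional p (F z) (A *v \<alpha>)) \<le> 0"
proof (rule derivative_nonpos_at_right_maximum[OF norming_functional_directional_derivative[OF F]])
  show "\<forall>\<^sub>F t in at_right 0. Re (norming_functional p (F z) (F (z + t *\<^sub>R \<alpha>)))
      \<le> Re (norming_functional p (F z) (F (z + 0 *\<^sub>R \<alpha>)))"
    using inward_direction_enters_ball[OF p z \<alpha>] eventually_on_segment[OF U, of \<alpha>]
  proof eventually_elim
    case (elim t)
    then have "F (z + t *\<^sub>R \<alpha>) \<in> lp_ball p" using into by blast
    from norming_functional_less_one[OF p w this]
    have "Re (norming_functional p (F z) (F (z + t *\<^sub>R \<alpha>))) \<le> 1"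
      using complex_Re_le_cmod order.trans less_imp_le by blast
    then show ?case using norming_functional_self[OF p w] by simp
  qed
qed

text \<open>
  On the kernel of \<open>Re \<ell>\<close> the real functional \<open>Re L\<close> is bounded above, since moving along the kernel
  from the fixed vector \<open>-e\<close> never leaves the open half-space; so it vanishes there. Hence \<open>Re L\<close> is a
  multiple of \<open>Re \<ell>\<close>, and imaginary parts follow by evaluating at \<open>\<i> x\<close>.
\<close>

lemma functional_multiple_of_half_space:
  fixes l L :: "complex ^ 'n \<Rightarrow> complex"
  assumes add: "\<And>x y. l (x + y) = l x + l y" "\<And>x y. L (x + y) = L x + L y"
    and scale: "\<And>c x. l (c *s x) = c * l x" "\<And>c x. L (c *s x) = c * L x"
    and e: "l e = 1" and half: "\<And>x. Re (l x) < 0 \<Longrightarrow> Re (L x) \<le> 0"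
  shows "L x = of_real (Re (L e)) * l x"
proof -
  have kernel: "Re (L x) = 0" if x: "Re (l x) = 0" for x
  proof (rule ccontr)
    assume nz: "Re (L x) \<noteq> 0"
    \<comment> \<open>With this \<open>k\<close> the real part of \<open>L (k x - e)\<close> is exactly 1.\<close>
    define k where "k = (Re (L e) + 1) / Re (L x)"
    have "Re (l (of_real k *s x + (-1) *s e)) < 0"
      unfolding add scale using x e by simp
    then have "Re (L (of_real k *s x + (-1) *s e)) \<le> 0" by (rule half)
    then show False unfolding add scale using nz by (simp add: k_def)
  qed
  have real_part: "Re (L x) = Re (L e) * Re (l x)" for x
  proof -
    have "Re (l (x + of_real (- Re (l x)) *s e)) = 0"
      unfolding add scale e by simp
    from kernel[OF this] have "Re (L x) - Re (l x) * Re (L e) = 0"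
      unfolding add scale by simp
    then show ?thesis by (simp add: mult.commute)
  qed
  from real_part[of x] real_part[of "\<i> *s x"] show ?thesis
    by (simp add: complex_eq_iff scale)
qed

lemma radial_slice_holomorphic:
  fixes f :: "complex ^ 'n \<Rightarrow> complex ^ 'n"
  assumes f: "vec_holomorphic_on f (lp_ball p)" and p: "p \<ge> 2" and z: "z \<in> lp_sphere p"
  shows "(\<lambda>\<zeta>. norming_functional p w (f (\<zeta> *s z))) holomorphic_on ball 0 1"
proof (subst holomorphic_on_open, simp, intro ballI)
  fix \<zeta> :: complex assume "\<zeta> \<in> ball 0 1"
  then have "\<zeta> *s z \<in> lp_ball p" using scaled_sphere_in_ball[OF p z] by simp
  then obtain A :: "complex ^ 'n ^ 'n" where A: "(f has_derivative (\<lambda>h. A *v h)) (at (\<zeta> *s z))"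
    using f by (auto simp: vec_holomorphic_on_def)
  have "bounded_linear (\<lambda>\<zeta>. \<zeta> *s z)"
    by (intro linear_conv_bounded_linear[THEN iffD1] linearI)
       (auto simp: vec_eq_iff algebra_simps)
  then have "((\<lambda>\<zeta>. \<zeta> *s z) has_derivative (\<lambda>h. h *s z)) (at \<zeta>)"
    by (rule bounded_linear_imp_has_derivative)
  from has_derivative_compose[OF this A]
  have "((\<lambda>\<zeta>. norming_functional p w (f (\<zeta> *s z))) has_derivative
      (\<lambda>h. norming_functional p w (A *v (h *s z)))) (at \<zeta>)"
    by (rule bounded_linear.has_derivative[OF bounded_linear_norming_functional])
  moreover have "norming_functional p w (A *v (h *s z)) = norming_functional p w (A *v z) * h" for h
    by (simp add: vector_scalar_commute norming_functional_simps mult.commute)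
  ultimately have "((\<lambda>\<zeta>. norming_functional p w (f (\<zeta> *s z))) has_field_derivative
      norming_functional p w (A *v z)) (at \<zeta>)"
    by (simp add: has_field_derivative_def)
  then show "\<exists>f'. ((\<lambda>\<zeta>. norming_functional p w (f (\<zeta> *s z))) has_field_derivative f') (at \<zeta>)" ..
qed

lemma radial_derivative_ge_one:
  fixes f F :: "complex ^ 'n \<Rightarrow> complex ^ 'n"
  assumes p: "p \<ge> 2" and z: "z \<in> lp_sphere p" and w: "F z \<in> lp_sphere p"
    and f: "vec_holomorphic_on f (lp_ball p)" "f ` lp_ball p \<subseteq> lp_ball p" "f 0 = 0"
    and F: "(F has_derivative (\<lambda>h. A *v h)) (at z)"
    and U: "open U" "z \<in> U" and agree: "\<And>x. x \<in> U \<inter> lp_ball p \<Longrightarrow> F x = f x"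
  shows "Re (norming_functional p (F z) (A *v z)) \<ge> 1"
proof -
  define g where "g = (\<lambda>\<zeta>. norming_functional p (F z) (f (\<zeta> *s z)))"
  have "g holomorphic_on ball 0 1"
    unfolding g_def by (rule radial_slice_holomorphic[OF f(1) p z])
  moreover have "g 0 = 0" by (simp add: g_def f norming_functional_simps)
  moreover have "cmod (g \<zeta>) < 1" if "cmod \<zeta> < 1" for \<zeta>
    unfolding g_def using scaled_sphere_in_ball[OF p z that] f(2)
    by (intro norming_functional_less_one[OF p w]) auto
  ultimately have schwarz: "cmod (g \<zeta>) \<le> cmod \<zeta>" if "cmod \<zeta> < 1" for \<zeta>
    using that by (rule Schwarz_Lemma(1))
  \<comment> \<open>At distance \<open>t\<close> from the boundary the Schwarz bound is \<open>1 - t\<close>, with equality at \<open>t = 0\<close>.\<close>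
  define h where "h = (\<lambda>t::real. Re (norming_functional p (F z) (F (z + t *\<^sub>R (- z)))) - (1 - t))"
  have "(h has_real_derivative Re (norming_functional p (F z) (A *v (- z))) - (0 - 1)) (at 0)"
    unfolding h_def
    by (intro DERIV_diff norming_functional_directional_derivative F DERIV_const DERIV_ident)
  then have "Re (norming_functional p (F z) (A *v (- z))) - (0 - 1) \<le> 0"
  proof (rule derivative_nonpos_at_right_maximum)
    have "\<forall>\<^sub>F t::real in at_right 0. 0 < t \<and> t < 1"
      unfolding eventually_at_right_field by (intro exI[of _ 1]) auto
    then show "\<forall>\<^sub>F t in at_right 0. h t \<le> h 0"
      using eventually_on_segment[OF U, of "- z"]
    proof eventually_elim
      case (elim t)
      define \<zeta> where "\<zeta> = complex_of_real (1 - t)"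
      have \<zeta>: "cmod \<zeta> = 1 - t" "cmod \<zeta> < 1" using elim by (auto simp: \<zeta>_def simp del: of_real_diff)
      have eq: "z + t *\<^sub>R (- z) = \<zeta> *s z"
        by (simp add: vec_eq_iff complex_eq_iff \<zeta>_def algebra_simps)
      have "F (z + t *\<^sub>R (- z)) = f (\<zeta> *s z)"
        using agree elim scaled_sphere_in_ball[OF p z \<zeta>(2)] unfolding eq by auto
      then have "h t = Re (g \<zeta>) - (1 - t)" by (simp add: h_def g_def)
      also have "\<dots> \<le> 0" using complex_Re_le_cmod[of "g \<zeta>"] schwarz[OF \<zeta>(2)] \<zeta>(1) by linarith
      finally show ?case using norming_functional_self[OF p w] by (simp add: h_def)
    qed
  qed
  moreover have "norming_functional p (F z) (A *v (- z)) = - norming_functional p (F z) (A *v z)"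
    by (simp add: linear_neg[OF matrix_vector_mul_linear]
        linear_neg[OF bounded_linear.linear[OF bounded_linear_norming_functional]])
  ultimately show ?thesis by simp
qed

section \<open>The boundary Schwarz lemma\<close>

lemma complex_jacobian_eq:
  fixes F :: "complex ^ 'n \<Rightarrow> complex ^ 'm"
  assumes "(F has_derivative (\<lambda>h. A *v h)) (at z)"
  shows "complex_jacobian F z = A"
proof -
  have "((\<lambda>t. F (z + axis j t) $ i) has_field_derivative A $ i $ j) (at 0)" for i j
  proof -
    have "bounded_linear (\<lambda>t::complex. axis j t :: complex ^ 'n)"
      by (intro linear_conv_bounded_linear[THEN iffD1] linearI) (auto simp: vec_eq_iff axis_def)
    then have "((\<lambda>t. z + axis j t) has_derivative (\<lambda>t. axis j t)) (at (0::complex))"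
      by (auto intro!: derivative_eq_intros bounded_linear_imp_has_derivative)
    moreover have "z + axis j 0 = z" by (simp add: vec_eq_iff axis_def)
    ultimately have "((\<lambda>t. F (z + axis j t)) has_derivative (\<lambda>t. A *v axis j t)) (at 0)"
      using has_derivative_compose assms by metis
    from bounded_linear.has_derivative[OF bounded_linear_vec_nth this]
    have "((\<lambda>t. F (z + axis j t) $ i) has_derivative (\<lambda>t. (A *v axis j t) $ i)) (at 0)" .
    moreover have "(A *v axis j t) $ i = A $ i $ j * t" for t
      by (simp add: matrix_vector_mult_def axis_def if_distrib cong: if_cong)
    ultimately show ?thesis by (simp add: has_field_derivative_def)
  qed
  then show ?thesis by (simp add: complex_jacobian_def vec_eq_iff DERIV_imp_deriv)
qed

lemma lp_grad_pairing:
  assumes "p \<ge> 2"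
  shows "(\<Sum>j\<in>UNIV. cnj (lp_grad p z $ j) * \<alpha> $ j) = of_real p * norming_functional p z \<alpha>"
  by (simp add: lp_grad_eq[OF assms] norming_functional_def sum_distrib_left mult.assoc)

lemma lp_tangent_iff:
  assumes "p \<ge> 2"
  shows "\<alpha> \<in> lp_tangent p z \<longleftrightarrow> Re (norming_functional p z \<alpha>) = 0"
    and "\<alpha> \<in> lp_complex_tangent p z \<longleftrightarrow> norming_functional p z \<alpha> = 0"
  using assms by (auto simp: lp_tangent_def lp_complex_tangent_def lp_grad_pairing)

lemma conjugate_transpose_mult_eq_cnj:
  fixes A :: "complex ^ 'n ^ 'm"
  shows "transpose (map_matrix cnj A) *v v = cnj_vec (cnj_vec v v* A)"
  by (simp add: vec_eq_iff cnj_vec_def vector_matrix_mult_def map_matrix_def mult.commute)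

lemma conjugate_transpose_eigen_iff:
  fixes A :: "complex ^ 'n ^ 'm"
  shows "transpose (map_matrix cnj A) *v v = of_real l *s u \<longleftrightarrow> cnj_vec v v* A = of_real l *s cnj_vec u"
proof -
  have "cnj_vec x = of_real l *s u \<longleftrightarrow> x = of_real l *s cnj_vec u" for x
    unfolding vec_eq_iff cnj_vec_def complex_eq_iff
    by (intro iff_allI) (simp add: minus_equation_iff[of "Im _"] eq_commute)
  then show ?thesis by (simp only: conjugate_transpose_mult_eq_cnj)
qed

lemma norming_functional_mult_axis:
  fixes A :: "complex ^ 'n ^ 'n"
  shows "norming_functional p w (A *v axis j 1) = (cnj_vec (lp_v p w) v* A) $ j"
  by (simp add: norming_functional_def matrix_vector_mult_def axis_def cnj_vec_def
      vector_matrix_mult_def mult.commute if_distrib cong: if_cong)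

theorem theorem2p3:
  fixes p :: real
    and f F :: "complex ^ 'n \<Rightarrow> complex ^ 'n"
    and z0 w0 :: "complex ^ 'n"
  assumes "p \<ge> 2"
    and "vec_holomorphic_on f (lp_ball p)"
    and "f ` lp_ball p \<subseteq> lp_ball p"
    and "f 0 = 0"
    and "z0 \<in> lp_sphere p"
    and "holomorphic_extension_at f (lp_ball p) z0 F"
    and "F z0 = w0"
    and "w0 \<in> lp_sphere p"
  shows "((\<lambda>\<alpha>. complex_jacobian F z0 *v \<alpha>) ` lp_tangent p z0 \<subseteq> lp_tangent p w0
        \<and> (\<lambda>\<alpha>. complex_jacobian F z0 *v \<alpha>) ` lp_complex_tangent p z0 \<subseteq> lp_complex_tangent p w0)
      \<and> (\<exists>l::real. l \<ge> 1
          \<and> transpose (map_matrix cnj (complex_jacobian F z0)) *v lp_v p w0 = of_real l *s lp_v p z0)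
      \<and> (\<forall>l::real.
          transpose (map_matrix cnj (complex_jacobian F z0)) *v lp_v p w0 = of_real l *s lp_v p z0
          \<longleftrightarrow> cnj_vec (lp_v p w0) v* complex_jacobian F z0 = of_real l *s cnj_vec (lp_v p z0))"
proof -
  note p = assms(1) and z0 = assms(5)
  obtain U where U: "z0 \<in> U" "vec_holomorphic_on F U" and agree: "\<And>z. z \<in> U \<inter> lp_ball p \<Longrightarrow> F z = f z"
    using assms(6) by (auto simp: holomorphic_extension_at_def)
  have openU: "open U" using U by (simp add: vec_holomorphic_on_def)
  obtain A where A: "(F has_derivative (\<lambda>h. A *v h)) (at z0)"
    using U by (auto simp: vec_holomorphic_on_def)
  have w0: "F z0 \<in> lp_sphere p" using assms by simp
  have into: "F ` (U \<inter> lp_ball p) \<subseteq> lp_ball p"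
    using agree assms(3) by auto
  define l where "l = Re (norming_functional p (F z0) (A *v z0))"
  have "l \<ge> 1"
    unfolding l_def
    by (rule radial_derivative_ge_one[OF p z0 w0 assms(2,3,4) A openU U(1) agree])
  have multiple: "norming_functional p (F z0) (A *v \<alpha>) = of_real l * norming_functional p z0 \<alpha>" for \<alpha>
    unfolding l_def
  proof (rule functional_multiple_of_half_space[where L = "\<lambda>x. norming_functional p (F z0) (A *v x)"])
    show "norming_functional p z0 z0 = 1" by (rule norming_functional_self[OF p z0])
    show "Re (norming_functional p (F z0) (A *v x)) \<le> 0" if "Re (norming_functional p z0 x) < 0" for x
      using derivative_nonpos_in_inward_directions[OF p z0 w0 A openU U(1) into that] .
  qed (simp_all add: norming_functional_simps matrix_vector_right_distrib vector_scalar_commute)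
  have "cnj_vec (lp_v p w0) v* A = of_real l *s cnj_vec (lp_v p z0)"
    using multiple[of "axis _ 1"] assms(7)
    by (simp add: vec_eq_iff norming_functional_mult_axis norming_functional_simps cnj_vec_def)
  then have "transpose (map_matrix cnj A) *v lp_v p w0 = of_real l *s lp_v p z0"
    by (simp only: conjugate_transpose_eigen_iff)
  then show ?thesis
    unfolding complex_jacobian_eq[OF A] conjugate_transpose_eigen_iff
    using multiple \<open>l \<ge> 1\<close> assms(7)
    by (auto simp: lp_tangent_iff[OF p])
qed

end
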